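(* Let $n\geqslant 1$ be an integer. The monoid $\mathcal{PIO}_n^-$ of all order-decreasing elements of $\mathcal{PIO}_n$ has cardinality $$\lvert \mathcal{PIO}_{n}^{-}\rvert=2^{n+2}-\frac{(n+2)(n+3)}{2}.$$
   Context: $\Omega_n=\{1,\ldots,n\}$ with its natural order. A partial transformation of $\Omega_n$ is a map $\alpha$ from a subset $\operatorname{Dom}(\alpha)\subseteq\Omega_n$ (possibly empty) into $\Omega_n$, with image $\operatorname{Im}(\alpha)$. Maps are written on the right and composed from left to right: $x(\alpha\beta)=(x\alpha)\beta$, with $\operatorname{Dom}(\alpha\beta)=\{x\in\operatorname{Dom}(\alpha)\mid x\alpha\in\operatorname{Dom}(\beta)\}$. $\alpha$ is order-preserving if $x\leqslant y$ implies $x\alpha\leqslant y\alpha$ for all $x,y\in\operatorname{Dom}(\alpha)$, and order-decreasing if $x\alpha\leqslant x$ for all $x\in\operatorname{Dom}(\alpha)$. A subset $I\subseteq\Omega_n$ (possibly empty) is an interval if for all $x,y,z\in\Omega_n$, $x\leqslant y\leqslant z$ and $x,z\in I$ imply $y\in I$. $\mathcal{PIO}_n$ is the monoid, under composition, of all order-preserving partial transformations $\alpha$ of $\Omega_n$ such that $\operatorname{Dom}(\alpha)$ and $\operatorname{Im}(\alpha)$ are both intervals of $\Omega_n$ (it includes the empty transformation), and $\mathcal{PIO}_n^-$ is its submonoid of order-decreasing elements. *)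

theory Defs
  imports Complex_Main "HOL-Algebra.Group"
begin

definition Omega :: "nat \<Rightarrow> nat set" where
  "Omega n = {1..n}"

definition partial_transformation :: "nat \<Rightarrow> (nat \<rightharpoonup> nat) \<Rightarrow> bool" where
  "partial_transformation n \<alpha> \<longleftrightarrow> dom \<alpha> \<subseteq> Omega n \<and> ran \<alpha> \<subseteq> Omega n"

definition order_preserving :: "(nat \<rightharpoonup> nat) \<Rightarrow> bool" where
  "order_preserving \<alpha> \<longleftrightarrow>
     (\<forall>x \<in> dom \<alpha>. \<forall>y \<in> dom \<alpha>. x \<le> y \<longrightarrow> the (\<alpha> x) \<le> the (\<alpha> y))"

definition order_decreasing :: "(nat \<rightharpoonup> nat) \<Rightarrow> bool" where
  "order_decreasing \<alpha> \<longleftrightarrow> (\<forall>x \<in> dom \<alpha>. the (\<alpha> x) \<le> x)"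

definition interval :: "nat \<Rightarrow> nat set \<Rightarrow> bool" where
  "interval n I \<longleftrightarrow> I \<subseteq> Omega n \<and>
     (\<forall>x \<in> Omega n. \<forall>y \<in> Omega n. \<forall>z \<in> Omega n.
        x \<le> y \<and> y \<le> z \<and> x \<in> I \<and> z \<in> I \<longrightarrow> y \<in> I)"

text \<open>Products are read from left to right, so the product of \<open>\<alpha>\<close> and \<open>\<beta>\<close> applies
  \<open>\<alpha>\<close> first, whereas \<open>f \<circ>\<^sub>m g\<close> applies \<open>g\<close> first.\<close>

definition PIO :: "nat \<Rightarrow> (nat \<rightharpoonup> nat) monoid" where
  "PIO n = \<lparr>
     carrier = {\<alpha>. partial_transformation n \<alpha> \<and> order_preserving \<alpha> \<and>
                   interval n (dom \<alpha>) \<and> interval n (ran \<alpha>)},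
     mult = (\<lambda>\<alpha> \<beta>. \<beta> \<circ>\<^sub>m \<alpha>),
     one = Some |` Omega n \<rparr>"

definition PIO_minus :: "nat \<Rightarrow> (nat \<rightharpoonup> nat) monoid" where
  "PIO_minus n = (PIO n)\<lparr>carrier := {\<alpha> \<in> carrier (PIO n). order_decreasing \<alpha>}\<rparr>"

lemma dom_mult: "dom (\<beta> \<circ>\<^sub>m \<alpha>) = {x \<in> dom \<alpha>. the (\<alpha> x) \<in> dom \<beta>}"
  by (auto simp: map_comp_def split: option.splits)

lemma interval_iff:
  "interval n I \<longleftrightarrow> I \<subseteq> Omega n \<and> (\<forall>x y z. x \<le> y \<and> y \<le> z \<and> x \<in> I \<and> z \<in> I \<longrightarrow> y \<in> I)"
  unfolding interval_def Omega_def by (meson atLeastAtMost_iff order_trans subsetD)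

lemma order_preservingD:
  "order_preserving \<alpha> \<Longrightarrow> \<alpha> x = Some a \<Longrightarrow> \<alpha> y = Some b \<Longrightarrow> x \<le> y \<Longrightarrow> a \<le> b"
  unfolding order_preserving_def by force

lemma PIO_closed:
  assumes "\<alpha> \<in> carrier (PIO n)" "\<beta> \<in> carrier (PIO n)"
  shows "\<beta> \<circ>\<^sub>m \<alpha> \<in> carrier (PIO n)"
proof -
  have a: "dom \<alpha> \<subseteq> Omega n" "order_preserving \<alpha>" "interval n (dom \<alpha>)" "interval n (ran \<alpha>)"
   and b: "ran \<beta> \<subseteq> Omega n" "order_preserving \<beta>" "interval n (dom \<beta>)" "interval n (ran \<beta>)"
    using assms by (auto simp: PIO_def partial_transformation_def)
  have comp: "(\<beta> \<circ>\<^sub>m \<alpha>) x = Some c \<longleftrightarrow> (\<exists>b. \<alpha> x = Some b \<and> \<beta> b = Some c)" for x c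
    by (auto simp: map_comp_def split: option.splits)
  have sub: "dom (\<beta> \<circ>\<^sub>m \<alpha>) \<subseteq> Omega n" "ran (\<beta> \<circ>\<^sub>m \<alpha>) \<subseteq> Omega n"
    using a(1) b(1) by (auto simp: dom_def ran_def comp)
  have op: "order_preserving (\<beta> \<circ>\<^sub>m \<alpha>)"
    unfolding order_preserving_def
  proof (intro ballI impI)
    fix x y assume "x \<in> dom (\<beta> \<circ>\<^sub>m \<alpha>)" "y \<in> dom (\<beta> \<circ>\<^sub>m \<alpha>)" and le: "x \<le> y"
    then obtain p q c d where
      pq: "\<alpha> x = Some p" "\<beta> p = Some c" "\<alpha> y = Some q" "\<beta> q = Some d"
      by (auto simp: dom_def comp)
    have "c \<le> d"
      using order_preservingD[OF b(2) pq(2,4)] order_preservingD[OF a(2) pq(1,3) le] by blast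
    then show "the ((\<beta> \<circ>\<^sub>m \<alpha>) x) \<le> the ((\<beta> \<circ>\<^sub>m \<alpha>) y)" using pq by simp
  qed
  have "y \<in> dom (\<beta> \<circ>\<^sub>m \<alpha>)"
    if xyz: "x \<le> y" "y \<le> z" "x \<in> dom (\<beta> \<circ>\<^sub>m \<alpha>)" "z \<in> dom (\<beta> \<circ>\<^sub>m \<alpha>)" for x y z
  proof -
    obtain p q where pq: "\<alpha> x = Some p" "p \<in> dom \<beta>" "\<alpha> z = Some q" "q \<in> dom \<beta>"
      using xyz(3,4) by (auto simp: dom_def comp)
    have "x \<in> dom \<alpha>" "z \<in> dom \<alpha>" using pq by auto
    then have "y \<in> dom \<alpha>" using a(3) xyz(1,2) unfolding interval_iff by blast
    then obtain r where r: "\<alpha> y = Some r" by auto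
    then have "p \<le> r" "r \<le> q" using order_preservingD[OF a(2)] pq xyz(1,2) by blast+
    then have "r \<in> dom \<beta>" using b(3) pq unfolding interval_iff by blast
    then show ?thesis using r by (auto simp: dom_def comp)
  qed
  then have idom: "interval n (dom (\<beta> \<circ>\<^sub>m \<alpha>))" using sub(1) unfolding interval_iff by blast
  have "y \<in> ran (\<beta> \<circ>\<^sub>m \<alpha>)"
    if xyz: "x \<le> y" "y \<le> z" "x \<in> ran (\<beta> \<circ>\<^sub>m \<alpha>)" "z \<in> ran (\<beta> \<circ>\<^sub>m \<alpha>)" for x y z
  proof -
    obtain p q where pq: "p \<in> ran \<alpha>" "\<beta> p = Some x" "q \<in> ran \<alpha>" "\<beta> q = Some z"
      using xyz(3,4) by (auto simp: ran_def comp)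
    have "y \<in> ran \<beta>" using b(4) xyz(1,2) ranI[of \<beta>, OF pq(2)] ranI[of \<beta>, OF pq(4)]
      unfolding interval_iff by blast
    then obtain r where r: "\<beta> r = Some y" by (auto simp: ran_def)
    have "\<exists>s \<in> ran \<alpha>. \<beta> s = Some y"
    proof (cases "p \<le> r \<and> r \<le> q")
      case True
      then show ?thesis using a(4) pq(1,3) r unfolding interval_iff by blast
    next
      case False
      then have "y \<le> x \<or> z \<le> y"
        using order_preservingD[OF b(2)] r pq(2,4) by (meson nat_le_linear)
      then show ?thesis using xyz(1,2) pq by (metis le_antisym)
    qed
    then show ?thesis by (auto simp: ran_def comp)
  qed
  then have "interval n (ran (\<beta> \<circ>\<^sub>m \<alpha>))" using sub(2) unfolding interval_iff by blast
  with sub op idom show ?thesis by (simp add: PIO_def partial_transformation_def)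
qed

lemma PIO_one: "Some |` Omega n \<in> carrier (PIO n)"
proof -
  have "dom (Some |` Omega n) = Omega n" "ran (Some |` Omega n) = Omega n"
    by (auto simp: restrict_map_def ran_def split: if_split_asm)
  moreover have "order_preserving (Some |` Omega n)"
    by (simp add: order_preserving_def)
  ultimately show ?thesis
    by (simp add: PIO_def partial_transformation_def interval_def)
qed

lemma monoid_PIO: "monoid (PIO n)"
proof (rule monoidI)
  fix \<alpha> assume "\<alpha> \<in> carrier (PIO n)"
  then have d: "dom \<alpha> \<subseteq> Omega n" and r: "ran \<alpha> \<subseteq> Omega n"
    by (auto simp: PIO_def partial_transformation_def)
  show "\<one>\<^bsub>PIO n\<^esub> \<otimes>\<^bsub>PIO n\<^esub> \<alpha> = \<alpha>"
  proof
    fix x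
    show "(\<one>\<^bsub>PIO n\<^esub> \<otimes>\<^bsub>PIO n\<^esub> \<alpha>) x = \<alpha> x"
      using d by (cases "\<alpha> x") (auto simp: PIO_def map_comp_def restrict_map_def)
  qed
  show "\<alpha> \<otimes>\<^bsub>PIO n\<^esub> \<one>\<^bsub>PIO n\<^esub> = \<alpha>"
    using r by (auto simp: PIO_def map_comp_def restrict_map_def fun_eq_iff ran_def
        split: option.splits)
next
  fix \<alpha> \<beta> assume "\<alpha> \<in> carrier (PIO n)" "\<beta> \<in> carrier (PIO n)"
  then show "\<alpha> \<otimes>\<^bsub>PIO n\<^esub> \<beta> \<in> carrier (PIO n)"
    using PIO_closed[of \<alpha> n \<beta>] by (simp add: PIO_def)
next
  show "\<one>\<^bsub>PIO n\<^esub> \<in> carrier (PIO n)"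
    using PIO_one[of n] by (simp add: PIO_def)
next
  fix \<alpha> \<beta> \<gamma>
  show "\<alpha> \<otimes>\<^bsub>PIO n\<^esub> \<beta> \<otimes>\<^bsub>PIO n\<^esub> \<gamma> = \<alpha> \<otimes>\<^bsub>PIO n\<^esub> (\<beta> \<otimes>\<^bsub>PIO n\<^esub> \<gamma>)"
    by (auto simp: PIO_def map_comp_def fun_eq_iff split: option.splits)
qed

lemma submonoid_PIO_minus: "submonoid (carrier (PIO_minus n)) (PIO n)"
proof
  fix \<alpha> \<beta> assume ab: "\<alpha> \<in> carrier (PIO_minus n)" "\<beta> \<in> carrier (PIO_minus n)"
  then have dec: "order_decreasing \<alpha>" "order_decreasing \<beta>"
    by (auto simp: PIO_minus_def)
  have "order_decreasing (\<beta> \<circ>\<^sub>m \<alpha>)"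
    unfolding order_decreasing_def
  proof
    fix x assume "x \<in> dom (\<beta> \<circ>\<^sub>m \<alpha>)"
    then obtain b c where bc: "\<alpha> x = Some b" "\<beta> b = Some c"
      by (auto simp: dom_mult)
    then have "b \<le> x" "c \<le> b"
      using bspec[OF dec(1)[unfolded order_decreasing_def], of x]
        bspec[OF dec(2)[unfolded order_decreasing_def], of b] by auto
    then show "the ((\<beta> \<circ>\<^sub>m \<alpha>) x) \<le> x" using bc by simp
  qed
  moreover have "\<beta> \<circ>\<^sub>m \<alpha> \<in> carrier (PIO n)"
    using ab PIO_closed by (auto simp: PIO_minus_def)
  ultimately show "\<alpha> \<otimes>\<^bsub>PIO n\<^esub> \<beta> \<in> carrier (PIO_minus n)"
    by (simp add: PIO_minus_def PIO_def)
next
  show "\<one>\<^bsub>PIO n\<^esub> \<in> carrier (PIO_minus n)"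
    using PIO_one[of n] by (simp add: PIO_minus_def PIO_def order_decreasing_def)
qed (auto simp: PIO_minus_def)

lemma monoid_PIO_minus: "monoid (PIO_minus n)"
  using submonoid.submonoid_is_monoid[OF submonoid_PIO_minus monoid_PIO, of n]
  by (simp add: PIO_minus_def)

end

theory Submission
  imports Defs
begin

text \<open>
  A nonempty element of \<open>PIO_minus n\<close> is a lattice path. Its domain is a segment \<open>{i..m}\<close>, and because
  its image has no gaps, an order-preserving \<open>\<alpha>\<close> can only stay constant or go up by one from each
  point of the domain to the next (lemma \<open>PIO_step\<close>). So \<open>\<alpha>\<close> is determined by \<open>i\<close>, \<open>m\<close>, the
  initial value \<open>a\<close> and the set \<open>S \<subseteq> {i<..m}\<close> of points at which it goes up, and all such data occur.
  A path that starts at or below the diagonal and rises by at most one per step never crosses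
  the diagonal, hence being order-decreasing amounts to the single condition \<open>a \<le> i\<close>.

  For given \<open>m\<close> and \<open>i\<close> there are \<open>i\<close> choices of \<open>a\<close> and \<open>2 ^ (m - i)\<close> choices of \<open>S\<close>. Since
  \<open>(\<Sum>i=1..m. i * 2 ^ (m - i)) = 2 ^ (m + 1) - m - 2\<close>, summing over \<open>m \<le> n\<close> and adding one for the
  empty map gives the formula.
\<close>

section \<open>Staircase maps\<close>

definition height :: "nat \<Rightarrow> nat \<Rightarrow> nat set \<Rightarrow> nat \<Rightarrow> nat" where
  "height i a S x = a + card (S \<inter> {i<..x})"

definition staircase :: "nat \<times> nat \<times> nat \<times> nat set \<Rightarrow> (nat \<rightharpoonup> nat)" where
  "staircase = (\<lambda>(m, i, a, S) x. if x \<in> {i..m} then Some (height i a S x) else None)"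

text \<open>The right end \<open>m\<close> of the domain comes first because the number of data with a given \<open>m\<close> has a
  closed form that does not depend on \<open>n\<close>.\<close>

definition staircase_data :: "nat \<Rightarrow> (nat \<times> nat \<times> nat \<times> nat set) set" where
  "staircase_data n = (SIGMA m:{1..n}. SIGMA i:{1..m}. {1..i} \<times> Pow {i<..m})"

lemma mem_staircase_data:
  "(m, i, a, S) \<in> staircase_data n \<longleftrightarrow>
     1 \<le> a \<and> a \<le> i \<and> i \<le> m \<and> m \<le> n \<and> S \<subseteq> {i<..m}"
  by (auto simp: staircase_data_def)

lemma dom_staircase: "dom (staircase (m, i, a, S)) = {i..m}"
  by (auto simp: staircase_def dom_def)

lemma ran_staircase: "ran (staircase (m, i, a, S)) = height i a S ` {i..m}"
  by (auto simp: staircase_def ran_def)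

lemma height_start: "height i a S i = a"
  by (simp add: height_def)

lemma height_Suc:
  assumes "i \<le> x"
  shows "height i a S (Suc x) = height i a S x + (if Suc x \<in> S then 1 else 0)"
proof -
  have "{i<..Suc x} = insert (Suc x) {i<..x}"
    using assms by auto
  then show ?thesis
    by (simp add: height_def)
qed

lemma height_mono: "x \<le> y \<Longrightarrow> height i a S x \<le> height i a S y"
  unfolding height_def by (intro add_left_mono card_mono) auto

lemma height_le:
  assumes "a \<le> i" "i \<le> x"
  shows "height i a S x \<le> x"
  using assms(2)
proof (induction x rule: dec_induct)
  case base
  show ?case
    using assms(1) by (simp add: height_start)
next
  case (step x)
  then show ?case
    by (simp add: height_Suc)
qed

text \<open>A discrete intermediate value property: a path rising by at most one per step
  skips no value. This makes the image of a staircase map an interval.\<close>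

lemma height_intermediate:
  assumes "i \<le> z" "a \<le> y" "y \<le> height i a S z"
  shows "\<exists>w\<in>{i..z}. height i a S w = y"
  using assms(1,3)
proof (induction z rule: dec_induct)
  case base
  then show ?case
    using assms(2) by (simp add: height_start)
next
  case (step z)
  show ?case
  proof (cases "y \<le> height i a S z")
    case True
    then show ?thesis
      using step.IH by force
  next
    case False
    then have "height i a S (Suc z) = y"
      using step.prems step.hyps by (simp add: height_Suc split: if_splits)
    then show ?thesis
      using step.hyps by force
  qed
qed

section \<open>Nonempty elements as staircase maps\<close>

lemma staircase_in_PIO_minus:
  assumes "(m, i, a, S) \<in> staircase_data n"
  shows "staircase (m, i, a, S) \<in> carrier (PIO_minus n)"
proof -
  let ?h = "height i a S" and ?\<alpha> = "staircase (m, i, a, S)"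
  have b: "1 \<le> a" "a \<le> i" "i \<le> m" "m \<le> n"
    using assms by (auto simp: mem_staircase_data)
  have ge: "a \<le> ?h x" for x
    by (simp add: height_def)
  have le: "?h x \<le> x" if "i \<le> x" for x
    using height_le b that by blast
  have ran: "ran ?\<alpha> \<subseteq> Omega n"
  proof
    fix y assume "y \<in> ran ?\<alpha>"
    then obtain x where "x \<in> {i..m}" "y = ?h x"
      by (auto simp: ran_staircase)
    then show "y \<in> Omega n"
      using b ge[of x] le[of x] by (simp add: Omega_def)
  qed
  have dom: "dom ?\<alpha> \<subseteq> Omega n"
    using b by (auto simp: dom_staircase Omega_def)
  have "y \<in> ran ?\<alpha>" if xyz: "x \<le> y" "y \<le> z" "x \<in> ran ?\<alpha>" "z \<in> ran ?\<alpha>" for x y z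
  proof -
    obtain t where t: "t \<in> {i..m}" "z = ?h t"
      using xyz(4) by (auto simp: ran_staircase)
    have "a \<le> y"
      using xyz(1,3) ge by (auto simp: ran_staircase intro: order_trans)
    then obtain w where "w \<in> {i..t}" "?h w = y"
      using height_intermediate[of i t a y S] t xyz(2) by auto
    then show ?thesis
      using t by (force simp: ran_staircase)
  qed
  then have "interval n (ran ?\<alpha>)"
    using ran unfolding interval_iff by blast
  moreover have "interval n (dom ?\<alpha>)"
    using dom unfolding interval_iff by (auto simp: dom_staircase)
  moreover have "order_preserving ?\<alpha>"
    unfolding order_preserving_def dom_staircase by (simp add: staircase_def height_mono)
  moreover have "order_decreasing ?\<alpha>"
    unfolding order_decreasing_def dom_staircase by (simp add: staircase_def le)
  ultimately show ?thesis
    using dom ran by (simp add: PIO_minus_def PIO_def partial_transformation_def)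
qed

text \<open>If \<open>\<alpha>\<close> rose by two or more in one step, the value just above \<open>p\<close> would have to be attained
  strictly between \<open>x\<close> and \<open>Suc x\<close>.\<close>

lemma PIO_step:
  assumes "\<alpha> \<in> carrier (PIO n)" "\<alpha> x = Some p" "\<alpha> (Suc x) = Some q"
  shows "q = p \<or> q = Suc p"
proof (rule ccontr)
  have op: "order_preserving \<alpha>" and ran: "interval n (ran \<alpha>)"
    using assms(1) by (auto simp: PIO_def)
  assume "\<not> ?thesis"
  moreover have "p \<le> q"
    using order_preservingD[OF op assms(2,3)] by simp
  ultimately have pq: "Suc p < q"
    by simp
  moreover have "p \<in> ran \<alpha>" "q \<in> ran \<alpha>"
    using assms(2,3) by (auto intro: ranI)
  ultimately have "Suc p \<in> ran \<alpha>"
    using ran unfolding interval_iff by (meson le_SucI less_imp_le order_refl)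
  then obtain z where z: "\<alpha> z = Some (Suc p)"
    by (auto simp: ran_def)
  show False
  proof (cases "z \<le> x")
    case True
    then show ?thesis
      using order_preservingD[OF op z assms(2)] by simp
  next
    case False
    then show ?thesis
      using order_preservingD[OF op assms(3) z] pq by simp
  qed
qed

lemma interval_nonempty_eq:
  assumes "interval n I" "I \<noteq> {}"
  shows "I = {Min I..Max I}"
proof -
  have fin: "finite I"
    using assms(1) by (auto simp: interval_def Omega_def intro: finite_subset)
  have "Min I \<in> I" "Max I \<in> I"
    using fin assms(2) by auto
  then have "{Min I..Max I} \<subseteq> I"
    using assms(1) unfolding interval_iff by (meson atLeastAtMost_iff subsetI)
  moreover have "I \<subseteq> {Min I..Max I}"
    using fin by (simp add: subset_iff)
  ultimately show ?thesis
    by (rule equalityI[rotated])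
qed

text \<open>The set \<open>S\<close> of rises is recovered as the set of points where \<open>\<alpha>\<close> differs from its value one
  step before; since every rise is by exactly one, counting rises from \<open>i\<close> onwards gives \<open>\<alpha>\<close> back.\<close>

lemma PIO_minus_nonempty_staircase:
  assumes \<alpha>: "\<alpha> \<in> carrier (PIO_minus n)" and ne: "\<alpha> \<noteq> Map.empty"
  shows "\<alpha> \<in> staircase ` staircase_data n"
proof -
  have PIO: "\<alpha> \<in> carrier (PIO n)" and dec: "order_decreasing \<alpha>"
    using \<alpha> by (auto simp: PIO_minus_def)
  have dom: "dom \<alpha> \<subseteq> Omega n" "interval n (dom \<alpha>)" and ran: "ran \<alpha> \<subseteq> Omega n"
    using PIO by (auto simp: PIO_def partial_transformation_def)
  have dom_ne: "dom \<alpha> \<noteq> {}"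
    using ne by simp
  define i m where "i = Min (dom \<alpha>)" and "m = Max (dom \<alpha>)"
  have dom_eq: "dom \<alpha> = {i..m}"
    unfolding i_def m_def by (rule interval_nonempty_eq[OF dom(2) dom_ne])
  then have im: "i \<le> m"
    using dom_ne by simp
  have m_le: "m \<le> n"
    using dom(1) dom_eq im by (auto simp: Omega_def)
  define a where "a = the (\<alpha> i)"
  define S where "S = {x \<in> {i<..m}. \<alpha> x \<noteq> \<alpha> (x - 1)}"
  have i_dom: "i \<in> dom \<alpha>"
    unfolding dom_eq using im by simp
  then have ai: "\<alpha> i = Some a"
    by (auto simp: a_def)
  have "1 \<le> a"
    using ran ranI[of \<alpha>, OF ai] by (auto simp: Omega_def)
  moreover have "a \<le> i"
    using dec i_dom by (simp add: order_decreasing_def a_def)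
  ultimately have data: "(m, i, a, S) \<in> staircase_data n"
    using im m_le by (auto simp: mem_staircase_data S_def)
  have val: "x \<le> m \<longrightarrow> \<alpha> x = Some (height i a S x)" if "i \<le> x" for x
    using that
  proof (induction x rule: dec_induct)
    case base
    show ?case
      using ai by (simp add: height_start)
  next
    case (step x)
    show ?case
    proof
      assume le: "Suc x \<le> m"
      then have p: "\<alpha> x = Some (height i a S x)"
        using step.IH by simp
      have "Suc x \<in> dom \<alpha>"
        unfolding dom_eq using le step.hyps by simp
      then obtain q where q: "\<alpha> (Suc x) = Some q"
        by auto
      have "Suc x \<in> S \<longleftrightarrow> q \<noteq> height i a S x"
        using le step.hyps p q by (simp add: S_def)
      then show "\<alpha> (Suc x) = Some (height i a S (Suc x))"
        using PIO_step[OF PIO p q] step.hyps q by (auto simp: height_Suc)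
    qed
  qed
  have "\<alpha> = staircase (m, i, a, S)"
  proof
    fix x
    show "\<alpha> x = staircase (m, i, a, S) x"
    proof (cases "x \<in> {i..m}")
      case True
      then show ?thesis
        using val by (simp add: staircase_def)
    next
      case False
      then have "\<alpha> x = None"
        using dom_eq by blast
      then show ?thesis
        using False by (auto simp: staircase_def)
    qed
  qed
  then show ?thesis
    using data by blast
qed

text \<open>The data are read off the map: \<open>i\<close> and \<open>m\<close> bound the domain, \<open>a\<close> is the value at \<open>i\<close>,
  and \<open>S\<close> consists of the points where the value changes.\<close>

lemma inj_on_staircase: "inj_on staircase (staircase_data n)"
proof (rule inj_onI)
  fix d d'
  assume d: "d \<in> staircase_data n" and d': "d' \<in> staircase_data n"
    and eq: "staircase d = staircase d'"
  obtain m i a S where ds: "d = (m, i, a, S)"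
    by (cases d)
  obtain m' i' a' S' where ds': "d' = (m', i', a', S')"
    by (cases d')
  have im: "i \<le> m" and S: "S \<subseteq> {i<..m}"
    using d ds by (auto simp: mem_staircase_data)
  have im': "i' \<le> m'" and S': "S' \<subseteq> {i'<..m'}"
    using d' ds' by (auto simp: mem_staircase_data)
  have "{i..m} = {i'..m'}"
    using arg_cong[OF eq, of dom] by (simp add: ds ds' dom_staircase)
  then have same: "i' = i" "m' = m"
    using im im' by (auto simp: Icc_eq_Icc)
  have h: "height i a S x = height i a' S' x" if "x \<in> {i..m}" for x
    using fun_cong[OF eq, of x] that by (simp add: ds ds' same staircase_def)
  have a: "a = a'"
    using h[of i] im by (simp add: height_start)
  have "x \<in> S \<longleftrightarrow> x \<in> S'" if x: "x \<in> {i<..m}" for x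
  proof -
    obtain y where y: "x = Suc y" "i \<le> y"
      using x by (cases x) auto
    then show ?thesis
      using h[of x] h[of y] x by (simp add: height_Suc split: if_splits)
  qed
  then have "S = S'"
    using S S' same by blast
  then show "d = d'"
    by (simp add: ds ds' same a)
qed

lemma carrier_PIO_minus_eq:
  "carrier (PIO_minus n) = insert Map.empty (staircase ` staircase_data n)"
proof -
  have "Map.empty \<in> carrier (PIO_minus n)"
    by (simp add: PIO_minus_def PIO_def partial_transformation_def order_preserving_def
        order_decreasing_def interval_def)
  then show ?thesis
    using staircase_in_PIO_minus PIO_minus_nonempty_staircase by fastforce
qed

section \<open>Counting\<close>

lemma sum_mult_power2_diff: "(\<Sum>i=1..m. i * 2 ^ (m - i)) + m + 2 = (2::nat) ^ (m + 1)"
proof (induction m)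
  case (Suc m)
  have "(\<Sum>i=1..m. i * 2 ^ (Suc m - i)) = 2 * (\<Sum>i=1..m. i * 2 ^ (m - i))"
    by (auto simp: sum_distrib_left Suc_diff_le intro!: sum.cong)
  then show ?case
    using Suc.IH by simp
qed simp

lemma card_staircase_data:
  "real (card (staircase_data n)) = 2 ^ (n + 2) - (real n + 2) * (real n + 3) / 2 - 1"
proof -
  have "card (staircase_data n) = (\<Sum>m=1..n. \<Sum>i=1..m. i * 2 ^ (m - i))"
    by (simp add: staircase_data_def card_cartesian_product card_Pow)
  also have "real \<dots> = (\<Sum>m=1..n. 2 ^ (m + 1) - real m - 2)"
    unfolding of_nat_sum[where A = "{1..n}"]
  proof (rule sum.cong)
    fix m
    have "real ((\<Sum>i=1..m. i * 2 ^ (m - i)) + m + 2) = real (2 ^ (m + 1))"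
      by (simp only: sum_mult_power2_diff)
    then show "real (\<Sum>i=1..m. i * 2 ^ (m - i)) = 2 ^ (m + 1) - real m - 2"
      by simp
  qed simp
  also have "\<dots> = 2 ^ (n + 2) - (real n + 2) * (real n + 3) / 2 - 1"
    by (induction n) (auto simp: field_simps)
  finally show ?thesis .
qed

theorem theorem12:
  fixes n :: nat
  assumes "n \<ge> 1"
  shows "real (card (carrier (PIO_minus n))) =
           2 ^ (n + 2) - (real n + 2) * (real n + 3) / 2"
proof -
  have fin: "finite (staircase_data n)"
    unfolding staircase_data_def by (intro finite_SigmaI finite_cartesian_product) auto
  have "dom \<alpha> \<noteq> {}" if "\<alpha> \<in> staircase ` staircase_data n" for \<alpha>
    using that by (force simp: mem_staircase_data dom_staircase)
  then have "Map.empty \<notin> staircase ` staircase_data n"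
    by fastforce
  then have "card (carrier (PIO_minus n)) = Suc (card (staircase_data n))"
    using fin by (simp add: carrier_PIO_minus_eq card_image[OF inj_on_staircase])
  then show ?thesis
    using card_staircase_data[of n] by simp
qed

end
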